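(* Suppose that $\operatorname{supp}(f)=\mathbb{Z}_n^2$. Consider the raster scan $\mathcal{T}$ and suppose that an object estimate $g$ and a probe estimate $\nu^{00}$ satisfy $$\nu^{kl}\odot g^{kl}=e^{\mathrm{i}\theta_{kl}}\mu^{kl}\odot f^{kl}\ \text{ on }\mathcal{M}^{kl},\qquad \theta_{kl}=\theta_{00}+\mathbf{r}\cdot(k,l),\qquad k,l=0,\dots,q-1,$$ where $\theta_{00}\in\mathbb{R}$ and $\mathbf{r}=(r_1,r_2)$ with $r_1,r_2$ integer multiples of $2\pi/q$. Then the following hold. (I) Let $\tau\le m/2$, with $\tau=m/p$ for an integer $p\ge2$. If $\nu^{00}_{00}=e^{\mathrm{i}\psi}\odot\mu^{00}_{00}$ for some $\psi\in\mathbb{C}^{\tau\times\tau}$, then $$\nu^{00}_{kl}=e^{-\mathrm{i}\mathbf{r}\cdot(k,l)}e^{\mathrm{i}\psi}\odot\mu^{00}_{kl},\quad k,l=0,\dots,p-1,$$ $$g_{kl}=e^{\mathrm{i}\theta_{00}}e^{\mathrm{i}\mathbf{r}\cdot(k,l)}e^{-\mathrm{i}\psi}\odot f_{kl},\quad k,l=0,\dots,q-1.$$ (II) Let $m/2<\tau<m$. If $$\nu^{00}_{ij}=e^{\mathrm{i}\psi_{ij}}\odot\mu^{00}_{ij},\quad i,j\in\{0,1\},$$ for some $\psi=\begin{bmatrix}\psi_{00}&\psi_{10}\\ \psi_{01}&\psi_{11}\end{bmatrix}\in\mathbb{C}^{\tau\times\tau}$, then for all $k,l=0,\dots,q-1$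 $$g^{kl}_{ij}=e^{\mathrm{i}\theta_{00}}e^{\mathrm{i}\mathbf{r}\cdot(k,l)}e^{-\mathrm{i}\psi_{ij}}\odot f^{kl}_{ij},\quad i,j\in\{0,1\}.$$ Moreover, $$\nu^{00}_{2j}=e^{-\mathrm{i}r_1}e^{\mathrm{i}\psi_{0j}}\odot\mu^{00}_{2j},\quad \nu^{00}_{j2}=e^{-\mathrm{i}r_2}e^{\mathrm{i}\psi_{j0}}\odot\mu^{00}_{j2}\quad (j=0,1),\qquad \nu^{00}_{22}=e^{-\mathrm{i}(r_1+r_2)}e^{\mathrm{i}\psi_{00}}\odot\mu^{00}_{22},$$ and hence, for all $k,l=0,\dots,q-1$, $$g^{kl}_{2j}=e^{\mathrm{i}\theta_{00}}e^{\mathrm{i}\mathbf{r}\cdot(k+1,l)}e^{-\mathrm{i}\psi_{0j}}\odot f^{kl}_{2j},\quad g^{kl}_{j2}=e^{\mathrm{i}\theta_{00}}e^{\mathrm{i}\mathbf{r}\cdot(k,l+1)}e^{-\mathrm{i}\psi_{j0}}\odot f^{kl}_{j2}\quad (j=0,1),$$ $$g^{kl}_{22}=e^{\mathrm{i}\theta_{00}}e^{\mathrm{i}\mathbf{r}\cdot(k+1,l+1)}e^{-\mathrm{i}\psi_{00}}\odot f^{kl}_{22}.$$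
   Context: Let $m<n$ be positive integers. The object domain is $\mathbb{Z}_n^2=\{0,\dots,n-1\}^2$ with periodic boundary condition, i.e. all additions of pixel positions and shifts are modulo $n$ in each coordinate. The object is $f:\mathbb{Z}_n^2\to\mathbb{C}$ and $\operatorname{supp}(f)=\{\mathbf{n}: f(\mathbf{n})\ne 0\}$. The initial probe area is $\mathcal{M}^{00}=\{0,\dots,m-1\}^2$; the probe $\mu^{00}$ has support exactly $\mathcal{M}^{00}$ (nonzero at every pixel of $\mathcal{M}^{00}$, zero outside). A probe estimate is any function $\nu^{00}$ on $\mathcal{M}^{00}$ (zero outside), an object estimate is any $g:\mathbb{Z}_n^2\to\mathbb{C}$. The raster scan $\mathcal{T}$ has step size $\tau=n/q$ ($\tau,q\in\mathbb{N}$) and shifts $\mathbf{t}_{kl}=\tau(k,l)$, $k,l=0,\dots,q-1$. Set $\mathcal{M}^{kl}=\mathcal{M}^{00}+\mathbf{t}_{kl}$, $\mu^{kl}(\mathbf{n})=\mu^{00}(\mathbf{n}-\mathbf{t}_{kl})$, $\nu^{kl}(\mathbf{n})=\nu^{00}(\mathbf{n}-\mathbf{t}_{kl})$; $f^{kl},g^{kl}$ are the restrictions of $f,g$ to $\mathcal{M}^{kl}$. $\odot$ is the entrywise product and $e^{\mathrm{i}\psi}$ is the entrywise exponential. Arrays are indexed so that the first index refers to the first coordinate. Blocks in case (I) ($\tau=m/p$, $p\ge 2$ integer): $\mu^{00}_{kl}$, $\nu^{00}_{kl}$ ($0\le k,l\le p-1$) are the $\tau\times\tau$ blocks $\mu^{00}_{kl}(\mathbf{a})=\mu^{00}(\tau(k,l)+\mathbf{a})$,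 $\nu^{00}_{kl}(\mathbf{a})=\nu^{00}(\tau(k,l)+\mathbf{a})$, and $f_{kl}$, $g_{kl}$ ($0\le k,l\le q-1$) are $f_{kl}(\mathbf{a})=f(\tau(k,l)+\mathbf{a})$, $g_{kl}(\mathbf{a})=g(\tau(k,l)+\mathbf{a})$, where $\mathbf{a}\in\{0,\dots,\tau-1\}^2$. Blocks in case (II) ($m/2<\tau<m$): let $I_0=\{0,\dots,m-\tau-1\}$, $I_1=\{m-\tau,\dots,\tau-1\}$, $I_2=\{\tau,\dots,m-1\}$, a partition of $\{0,\dots,m-1\}$ with $I_2=I_0+\tau$. For $i,j\in\{0,1,2\}$, $\mu^{00}_{ij},\nu^{00}_{ij}$ are the restrictions of $\mu^{00},\nu^{00}$ to $I_i\times I_j$, and $f^{kl}_{ij},g^{kl}_{ij}$ are the restrictions of $f,g$ to $\mathbf{t}_{kl}+I_i\times I_j$. Blocks are regarded as arrays indexed by relative position within the block, so that blocks of equal size are multiplied entrywise. The array $\psi$ is indexed by $\{0,\dots,\tau-1\}^2=(I_0\cup I_1)^2$, and $\psi_{ij}$, $i,j\in\{0,1\}$, is its restriction to $I_i\times I_j$. *)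

theory Defs
  imports "HOL-Analysis.Analysis"
begin

text \<open>Pixels are pairs of integers; addition of pairs is componentwise. A function on
  \<open>\<int>\<^sub>n\<^sup>2\<close> is a function on pixels of which only the values on the representatives
  \<open>{0..<n} \<times> {0..<n}\<close> matter; periodicity enters through \<open>wrap\<close>.\<close>

type_synonym pixel = "int \<times> int"
type_synonym array = "pixel \<Rightarrow> complex"

definition sq :: "int \<Rightarrow> pixel set" where
  "sq s = {0..<s} \<times> {0..<s}"

definition wrap :: "int \<Rightarrow> pixel \<Rightarrow> pixel" where
  "wrap n x = (fst x mod n, snd x mod n)"

definition supp :: "int \<Rightarrow> array \<Rightarrow> pixel set" where
  "supp n h = {x \<in> sq n. h x \<noteq> 0}"

definition shift :: "int \<Rightarrow> int \<Rightarrow> int \<Rightarrow> pixel" where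
  "shift \<tau> k l = (\<tau> * k, \<tau> * l)"

definition probe_area :: "int \<Rightarrow> int \<Rightarrow> int \<Rightarrow> int \<Rightarrow> int \<Rightarrow> pixel set" where
  "probe_area n m \<tau> k l = (\<lambda>x. wrap n (x + shift \<tau> k l)) ` sq m"

definition shifted_probe :: "int \<Rightarrow> int \<Rightarrow> array \<Rightarrow> int \<Rightarrow> int \<Rightarrow> array" where
  "shifted_probe n \<tau> \<mu> k l x = \<mu> (wrap n (x - shift \<tau> k l))"

text \<open>A block is an array indexed by the relative position with respect to its corner \<open>c\<close>.
  \<open>torus_block\<close> is for object blocks that may cross the periodic boundary.\<close>

definition block :: "pixel \<Rightarrow> array \<Rightarrow> array" where
  "block c h a = h (c + a)"

definition torus_block :: "int \<Rightarrow> pixel \<Rightarrow> array \<Rightarrow> array" where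
  "torus_block n c h a = h (wrap n (c + a))"

text \<open>For \<open>m/2 < \<tau> < m\<close>, the interval \<open>{0..<m}\<close> is cut into
  \<open>I\<^sub>0 = {0..<m-\<tau>}\<close>, \<open>I\<^sub>1 = {m-\<tau>..<\<tau>}\<close> and \<open>I\<^sub>2 = {\<tau>..<m}\<close>.\<close>

definition cut :: "int \<Rightarrow> int \<Rightarrow> nat \<Rightarrow> int" where
  "cut m \<tau> i = [0, m - \<tau>, \<tau>, m] ! i"

definition seg :: "int \<Rightarrow> int \<Rightarrow> nat \<Rightarrow> int set" where
  "seg m \<tau> i = {cut m \<tau> i ..< cut m \<tau> (Suc i)}"

definition corner :: "int \<Rightarrow> int \<Rightarrow> nat \<Rightarrow> nat \<Rightarrow> pixel" where
  "corner m \<tau> i j = (cut m \<tau> i, cut m \<tau> j)"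

text \<open>The relative positions within \<open>I\<^sub>i \<times> I\<^sub>j\<close>.\<close>

definition block_ix :: "int \<Rightarrow> int \<Rightarrow> nat \<Rightarrow> nat \<Rightarrow> pixel set" where
  "block_ix m \<tau> i j = {a. corner m \<tau> i j + a \<in> seg m \<tau> i \<times> seg m \<tau> j}"

definition phase :: "real \<times> real \<Rightarrow> int \<Rightarrow> int \<Rightarrow> real" where
  "phase r k l = r \<bullet> (real_of_int k, real_of_int l)"

end

theory Submission
  imports Defs
begin

text \<open>Write a pixel of the probe area as \<open>x = a + \<tau>(s, t)\<close> with \<open>a \<in> {0..<\<tau>}\<^sup>2\<close>. Because the phases
  \<open>\<theta>\<^sub>k\<^sub>l\<close> are affine in \<open>(k, l)\<close> and \<open>r\<^sub>1 q, r\<^sub>2 q\<close> are multiples of \<open>2\<pi>\<close>, the data equation extends to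
  all integer shifts. At the pixel \<open>a\<close> of the probe, where \<open>\<nu>/\<mu>\<close> is known, it determines \<open>g/f\<close> on
  \<open>a + \<tau>\<int>\<^sup>2\<close>; reading it with shift zero at \<open>x\<close> then determines \<open>\<nu>/\<mu>\<close> at \<open>x\<close>. Both regimes of \<open>\<tau>\<close> are
  instances of this.\<close>

section \<open>Periodic arithmetic of pixels, shifts and phases\<close>

lemma wrap_eqI:
  assumes "fst x mod n = fst y mod n" "snd x mod n = snd y mod n"
  shows "wrap n x = wrap n y"
  using assms by (simp add: wrap_def)

lemma wrap_id: "x \<in> sq n \<Longrightarrow> wrap n x = x"
  by (auto simp: wrap_def sq_def)

lemma wrap_in_sq: "0 < n \<Longrightarrow> wrap n x \<in> sq n"
  by (simp add: wrap_def sq_def)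

lemma sq_mono: "s \<le> t \<Longrightarrow> sq s \<subseteq> sq t"
  by (auto simp: sq_def)

lemma shifted_probe_wrap:
  assumes "x \<in> sq n"
  shows "shifted_probe n \<tau> \<mu> k l (wrap n (x + shift \<tau> k l)) = \<mu> x"
proof -
  have "wrap n (wrap n (x + shift \<tau> k l) - shift \<tau> k l) = wrap n x"
    by (rule wrap_eqI) (simp_all add: wrap_def shift_def mod_simps)
  then show ?thesis
    using assms by (simp add: shifted_probe_def wrap_id)
qed

lemma shift_add: "shift \<tau> (k + k') (l + l') = shift \<tau> k l + shift \<tau> k' l'"
  by (simp add: shift_def distrib_left)

lemma shift_zero [simp]: "shift \<tau> 0 0 = 0"
  by (simp add: shift_def zero_prod_def)

text \<open>Serves regime (I) twice: with \<open>s = p\<close> the blocks stay inside the probe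
  area, and with \<open>s = q\<close> they stay among the representatives of the torus, so
  \<open>wrap\<close> disappears from the object blocks.\<close>

lemma add_shift_in_sq:
  assumes "k \<in> {0..<s}" "l \<in> {0..<s}" "a \<in> sq \<tau>"
  shows "a + shift \<tau> k l \<in> sq (\<tau> * s)"
proof -
  have "0 \<le> b + \<tau> * i \<and> b + \<tau> * i < \<tau> * s" if "i \<in> {0..<s}" "0 \<le> b" "b < \<tau>" for i b
  proof -
    \<comment> \<open>Integrality gives \<open>i + 1 \<le> s\<close>, which leaves room for the
      offset \<open>b < \<tau>\<close>.\<close>
    have "\<tau> * (i + 1) \<le> \<tau> * s"
      using that by (intro mult_left_mono) auto
    then show ?thesis
      using that by (simp add: distrib_left)
  qed
  then show ?thesis
    using assms by (auto simp: sq_def shift_def)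
qed

lemma wrap_shift_mod:
  "wrap (\<tau> * q) (x + shift \<tau> (k mod q) (l mod q)) = wrap (\<tau> * q) (x + shift \<tau> k l)"
proof (rule wrap_eqI)
  have "\<tau> * (i mod q) = (\<tau> * i) mod (\<tau> * q)" for i
    by simp
  then show "fst (x + shift \<tau> (k mod q) (l mod q)) mod (\<tau> * q) = fst (x + shift \<tau> k l) mod (\<tau> * q)"
    and "snd (x + shift \<tau> (k mod q) (l mod q)) mod (\<tau> * q) = snd (x + shift \<tau> k l) mod (\<tau> * q)"
    by (simp_all only: shift_def fst_add snd_add fst_conv snd_conv mod_add_right_eq)
qed

text \<open>Changing \<open>k\<close> or \<open>l\<close> by a multiple of \<open>q\<close> changes
  the phase by full turns, because \<open>r1\<close> and \<open>r2\<close> are integer multiples of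
  \<open>2 * pi / q\<close>.\<close>

lemma exp_phase_mod:
  assumes "0 < q" "r1 = of_int c1 * (2 * pi / of_int q)" "r2 = of_int c2 * (2 * pi / of_int q)"
  shows "exp (\<i> * of_real (phase (r1, r2) (k mod q) (l mod q)))
    = exp (\<i> * of_real (phase (r1, r2) k l))"
proof -
  have *: "c * (2 * pi / of_int q) * of_int i
      = c * (2 * pi / of_int q) * of_int (i mod q) + c * of_int (i div q) * (2 * pi)" for c i
  proof -
    have "real_of_int i = of_int q * of_int (i div q) + of_int (i mod q)"
      by (metis mult_div_mod_eq of_int_add of_int_mult)
    then show ?thesis
      using \<open>0 < q\<close> by (simp only: distrib_left) simp
  qed
  \<comment> \<open>The total number of full turns lost by reducing both indices modulo
    \<open>q\<close>.\<close>
  define N where "N = c1 * (k div q) + c2 * (l div q)"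
  have "phase (r1, r2) k l = phase (r1, r2) (k mod q) (l mod q) + of_int N * (2 * pi)"
    using *[of "of_int c1" k] *[of "of_int c2" l]
    by (simp only: phase_def inner_prod_def inner_real_def fst_conv snd_conv assms N_def
        of_int_add of_int_mult distrib_right)
  \<comment> \<open>The coefficient \<open>2 * N\<close> gives the difference the shape of the
    witness in \<open>exp_eq\<close>.\<close>
  then have "\<i> * of_real (phase (r1, r2) k l)
      = \<i> * of_real (phase (r1, r2) (k mod q) (l mod q)) + of_real (of_int (2 * N) * pi) * \<i>"
    by (simp add: algebra_simps)
  then have "exp (\<i> * of_real (phase (r1, r2) k l))
      = exp (\<i> * of_real (phase (r1, r2) (k mod q) (l mod q)))"
    unfolding exp_eq by (rule exI)
  then show ?thesis ..
qed

text \<open>Collects what both regimes share. Nothing here compares \<open>\<tau>\<close> with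
  \<open>m\<close>, so the lemmas of the locale apply to (I) and (II) alike.\<close>

locale raster_scan =
  fixes m n \<tau> q :: int
    and f g \<mu> \<nu> :: array
    and \<theta> :: "int \<Rightarrow> int \<Rightarrow> real" and r1 r2 :: real
  assumes m_pos: "0 < m" and m_less: "m < n"
    and \<tau>_pos: "0 < \<tau>" and q_pos: "0 < q" and n_eq: "n = \<tau> * q"
    and supp_f: "supp n f = sq n"
    and supp_\<mu>: "supp n \<mu> = sq m"
    and data: "\<forall>k\<in>{0..<q}. \<forall>l\<in>{0..<q}. \<forall>x\<in>probe_area n m \<tau> k l.
           shifted_probe n \<tau> \<nu> k l x * g x
           = exp (\<i> * of_real (\<theta> k l)) * shifted_probe n \<tau> \<mu> k l x * f x"
    and \<theta>_affine: "\<forall>k\<in>{0..<q}. \<forall>l\<in>{0..<q}. \<theta> k l = \<theta> 0 0 + phase (r1, r2) k l"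
    and r1_eq: "\<exists>c::int. r1 = of_int c * (2 * pi / of_int q)"
    and r2_eq: "\<exists>c::int. r2 = of_int c * (2 * pi / of_int q)"
begin

section \<open>Phases of object and probe from the data equation\<close>

lemma f_nonzero: "f (wrap n x) \<noteq> 0"
proof -
  have "wrap n x \<in> supp n f"
    using supp_f wrap_in_sq m_pos m_less by simp
  then show ?thesis
    by (simp add: supp_def)
qed

lemma \<mu>_nonzero: "x \<in> sq m \<Longrightarrow> \<mu> x \<noteq> 0"
  using supp_\<mu> by (auto simp: supp_def)

text \<open>Reducing \<open>k\<close> and \<open>l\<close> modulo \<open>q\<close> changes neither
  the wrapped pixel nor the phase factor. Regime (II) needs this at \<open>k + 1\<close> and
  \<open>l + 1\<close>, which may equal \<open>q\<close>. The right-hand side uses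
  \<open>phase\<close> because \<open>\<theta>\<close> is only controlled on the index range of the
  scan.\<close>

lemma data_all_shifts:
  assumes "x \<in> sq m"
  shows "\<nu> x * g (wrap n (x + shift \<tau> k l))
    = exp (\<i> * of_real (\<theta> 0 0)) * exp (\<i> * of_real (phase (r1, r2) k l))
      * \<mu> x * f (wrap n (x + shift \<tau> k l))"
proof -
  define k' l' where "k' = k mod q" and "l' = l mod q"
  have range: "k' \<in> {0..<q}" "l' \<in> {0..<q}"
    using q_pos by (simp_all add: k'_def l'_def)
  have x: "x \<in> sq n"
    using assms sq_mono[of m n] m_less by auto
  have "wrap n (x + shift \<tau> k' l') \<in> probe_area n m \<tau> k' l'"
    using assms by (simp add: probe_area_def)
  then have "\<nu> x * g (wrap n (x + shift \<tau> k' l'))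
      = exp (\<i> * of_real (\<theta> k' l')) * \<mu> x * f (wrap n (x + shift \<tau> k' l'))"
    using data range shifted_probe_wrap[OF x] by metis
  moreover have "\<theta> k' l' = \<theta> 0 0 + phase (r1, r2) k' l'"
    using \<theta>_affine range by blast
  moreover have "exp (\<i> * of_real (phase (r1, r2) k' l')) = exp (\<i> * of_real (phase (r1, r2) k l))"
    using exp_phase_mod q_pos r1_eq r2_eq unfolding k'_def l'_def by blast
  moreover have "wrap n (x + shift \<tau> k' l') = wrap n (x + shift \<tau> k l)"
    using wrap_shift_mod by (simp add: n_eq k'_def l'_def)
  ultimately show ?thesis
    by (simp add: distrib_left exp_add)
qed

text \<open>At a pixel where the probe ratio is known, the nonzero factor \<open>\<mu> a\<close>
  cancels from the data equation and the exponential can be inverted.\<close>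

lemma object_phase:
  assumes "a \<in> sq m" "\<nu> a = exp (\<i> * z) * \<mu> a"
  shows "g (wrap n (a + shift \<tau> k l))
    = exp (\<i> * of_real (\<theta> 0 0)) * exp (\<i> * of_real (phase (r1, r2) k l))
      * exp (- \<i> * z) * f (wrap n (a + shift \<tau> k l))"
proof -
  have "exp (\<i> * z) * g (wrap n (a + shift \<tau> k l))
      = exp (\<i> * of_real (\<theta> 0 0)) * exp (\<i> * of_real (phase (r1, r2) k l))
        * f (wrap n (a + shift \<tau> k l))"
    using data_all_shifts[OF assms(1), of k l] \<mu>_nonzero[OF assms(1)] assms(2) by simp
  then show ?thesis
    by (simp add: exp_minus field_simps)
qed

text \<open>The object pixel at \<open>a + shift \<tau> s t\<close> is seen twice: by the probe
  pixel \<open>a\<close> under shift \<open>(s, t)\<close>, which fixes the ratio of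
  \<open>g\<close> to \<open>f\<close> there, and by the probe pixel
  \<open>a + shift \<tau> s t\<close> under shift zero, which passes that ratio on to the probe.
  Cancelling \<open>f\<close> uses its full support.\<close>

lemma probe_phase:
  assumes "a \<in> sq m" "\<nu> a = exp (\<i> * z) * \<mu> a" "a + shift \<tau> s t \<in> sq m"
  shows "\<nu> (a + shift \<tau> s t)
    = exp (- \<i> * of_real (phase (r1, r2) s t)) * exp (\<i> * z) * \<mu> (a + shift \<tau> s t)"
proof -
  \<comment> \<open>The reading with shift zero thus carries only the factor of
    \<open>\<theta> 0 0\<close>, which cancels against the same factor in
    \<open>object_phase\<close>.\<close>
  have "phase (r1, r2) 0 0 = 0"
    by (simp add: phase_def)
  then show ?thesis
    using data_all_shifts[OF assms(3), of 0 0] object_phase[OF assms(1,2), of s t]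
      f_nonzero[of "a + shift \<tau> s t"]
    by (simp add: exp_minus field_simps)
qed

end

section \<open>Geometry of the cut into three segments\<close>

lemma cut_simps [simp]:
  "cut m \<tau> 0 = 0" "cut m \<tau> (Suc 0) = m - \<tau>"
  "cut m \<tau> (Suc (Suc 0)) = \<tau>" "cut m \<tau> 2 = \<tau>" "cut m \<tau> 3 = m"
  by (simp_all add: cut_def eval_nat_numeral)

lemma block_ix_iff:
  "a \<in> block_ix m \<tau> i j \<longleftrightarrow>
    cut m \<tau> i \<le> cut m \<tau> i + fst a \<and> cut m \<tau> i + fst a < cut m \<tau> (Suc i) \<and>
    cut m \<tau> j \<le> cut m \<tau> j + snd a \<and> cut m \<tau> j + snd a < cut m \<tau> (Suc j)"
  by (cases a) (auto simp: block_ix_def corner_def seg_def)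

text \<open>The third segment is the first one translated by \<open>\<tau>\<close>, both of length
  \<open>m - \<tau>\<close>, so relative positions carry over unchanged.\<close>

lemma block_ix_2:
  "a \<in> block_ix m \<tau> 2 j \<longleftrightarrow> a \<in> block_ix m \<tau> 0 j"
  "a \<in> block_ix m \<tau> i 2 \<longleftrightarrow> a \<in> block_ix m \<tau> i 0"
  by (auto simp: block_ix_iff)

text \<open>Passing from index 0 to index 2 is exactly one scan step; this is what makes
  \<open>probe_phase\<close> applicable to the blocks with index 2.\<close>

lemma corner_2:
  "corner m \<tau> 2 j = corner m \<tau> 0 j + shift \<tau> 1 0"
  "corner m \<tau> i 2 = corner m \<tau> i 0 + shift \<tau> 0 1"
  by (simp_all add: corner_def shift_def)

lemma corner_22: "corner m \<tau> 2 2 = corner m \<tau> 0 0 + shift \<tau> 1 1"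
  by (simp add: corner_def shift_def)

section \<open>The two regimes of \<open>\<tau>\<close>\<close>

theorem theorem4p3:
  fixes m n \<tau> q :: int
    and f g \<mu> \<nu> :: array
    and \<theta> :: "int \<Rightarrow> int \<Rightarrow> real" and r1 r2 :: real
  assumes "0 < m" "m < n" and "0 < \<tau>" "0 < q" "n = \<tau> * q"
    and "supp n f = sq n"
    and "supp n \<mu> = sq m" and "supp n \<nu> \<subseteq> sq m"
    and "\<forall>k\<in>{0..<q}. \<forall>l\<in>{0..<q}. \<forall>x\<in>probe_area n m \<tau> k l.
           shifted_probe n \<tau> \<nu> k l x * g x
           = exp (\<i> * of_real (\<theta> k l)) * shifted_probe n \<tau> \<mu> k l x * f x"
    and "\<forall>k\<in>{0..<q}. \<forall>l\<in>{0..<q}. \<theta> k l = \<theta> 0 0 + phase (r1, r2) k l"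
    and "\<exists>c::int. r1 = of_int c * (2 * pi / of_int q)"
    and "\<exists>c::int. r2 = of_int c * (2 * pi / of_int q)"
  shows
    "(\<forall>(p::int) (\<psi>::array).
        2 * \<tau> \<le> m \<longrightarrow> 2 \<le> p \<longrightarrow> m = \<tau> * p \<longrightarrow>
        (\<forall>a\<in>sq \<tau>. block (shift \<tau> 0 0) \<nu> a
             = exp (\<i> * \<psi> a) * block (shift \<tau> 0 0) \<mu> a) \<longrightarrow>
        (\<forall>k\<in>{0..<p}. \<forall>l\<in>{0..<p}. \<forall>a\<in>sq \<tau>.
           block (shift \<tau> k l) \<nu> a
           = exp (- \<i> * of_real (phase (r1, r2) k l)) * exp (\<i> * \<psi> a)
             * block (shift \<tau> k l) \<mu> a) \<and>
        (\<forall>k\<in>{0..<q}. \<forall>l\<in>{0..<q}. \<forall>a\<in>sq \<tau>.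
           block (shift \<tau> k l) g a
           = exp (\<i> * of_real (\<theta> 0 0)) * exp (\<i> * of_real (phase (r1, r2) k l))
             * exp (- \<i> * \<psi> a) * block (shift \<tau> k l) f a))
     \<and>
     (\<forall>\<psi>::array.
        m < 2 * \<tau> \<longrightarrow> \<tau> < m \<longrightarrow>
        (\<forall>i\<in>{0, 1}. \<forall>j\<in>{0, 1}. \<forall>a\<in>block_ix m \<tau> i j.
           block (corner m \<tau> i j) \<nu> a
           = exp (\<i> * block (corner m \<tau> i j) \<psi> a) * block (corner m \<tau> i j) \<mu> a) \<longrightarrow>
        (\<forall>k\<in>{0..<q}. \<forall>l\<in>{0..<q}. \<forall>i\<in>{0, 1}. \<forall>j\<in>{0, 1}. \<forall>a\<in>block_ix m \<tau> i j.
           torus_block n (shift \<tau> k l + corner m \<tau> i j) g a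
           = exp (\<i> * of_real (\<theta> 0 0)) * exp (\<i> * of_real (phase (r1, r2) k l))
             * exp (- \<i> * block (corner m \<tau> i j) \<psi> a)
             * torus_block n (shift \<tau> k l + corner m \<tau> i j) f a) \<and>
        (\<forall>j\<in>{0, 1}. \<forall>a\<in>block_ix m \<tau> 2 j.
           block (corner m \<tau> 2 j) \<nu> a
           = exp (- \<i> * of_real r1) * exp (\<i> * block (corner m \<tau> 0 j) \<psi> a)
             * block (corner m \<tau> 2 j) \<mu> a) \<and>
        (\<forall>j\<in>{0, 1}. \<forall>a\<in>block_ix m \<tau> j 2.
           block (corner m \<tau> j 2) \<nu> a
           = exp (- \<i> * of_real r2) * exp (\<i> * block (corner m \<tau> j 0) \<psi> a)
             * block (corner m \<tau> j 2) \<mu> a) \<and>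
        (\<forall>a\<in>block_ix m \<tau> 2 2.
           block (corner m \<tau> 2 2) \<nu> a
           = exp (- \<i> * of_real (r1 + r2)) * exp (\<i> * block (corner m \<tau> 0 0) \<psi> a)
             * block (corner m \<tau> 2 2) \<mu> a) \<and>
        (\<forall>k\<in>{0..<q}. \<forall>l\<in>{0..<q}. \<forall>j\<in>{0, 1}. \<forall>a\<in>block_ix m \<tau> 2 j.
           torus_block n (shift \<tau> k l + corner m \<tau> 2 j) g a
           = exp (\<i> * of_real (\<theta> 0 0)) * exp (\<i> * of_real (phase (r1, r2) (k + 1) l))
             * exp (- \<i> * block (corner m \<tau> 0 j) \<psi> a)
             * torus_block n (shift \<tau> k l + corner m \<tau> 2 j) f a) \<and>
        (\<forall>k\<in>{0..<q}. \<forall>l\<in>{0..<q}. \<forall>j\<in>{0, 1}. \<forall>a\<in>block_ix m \<tau> j 2.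
           torus_block n (shift \<tau> k l + corner m \<tau> j 2) g a
           = exp (\<i> * of_real (\<theta> 0 0)) * exp (\<i> * of_real (phase (r1, r2) k (l + 1)))
             * exp (- \<i> * block (corner m \<tau> j 0) \<psi> a)
             * torus_block n (shift \<tau> k l + corner m \<tau> j 2) f a) \<and>
        (\<forall>k\<in>{0..<q}. \<forall>l\<in>{0..<q}. \<forall>a\<in>block_ix m \<tau> 2 2.
           torus_block n (shift \<tau> k l + corner m \<tau> 2 2) g a
           = exp (\<i> * of_real (\<theta> 0 0)) * exp (\<i> * of_real (phase (r1, r2) (k + 1) (l + 1)))
             * exp (- \<i> * block (corner m \<tau> 0 0) \<psi> a)
             * torus_block n (shift \<tau> k l + corner m \<tau> 2 2) f a))"
proof -
  interpret raster_scan m n \<tau> q f g \<mu> \<nu> \<theta> r1 r2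
    by unfold_locales fact+
  have phase_simps: "phase (r1, r2) 1 0 = r1" "phase (r1, r2) 0 1 = r2" "phase (r1, r2) 1 1 = r1 + r2"
    by (simp_all add: phase_def)
  have part1:
    "(\<forall>k\<in>{0..<p}. \<forall>l\<in>{0..<p}. \<forall>a\<in>sq \<tau>.
        block (shift \<tau> k l) \<nu> a
        = exp (- \<i> * of_real (phase (r1, r2) k l)) * exp (\<i> * \<psi> a) * block (shift \<tau> k l) \<mu> a) \<and>
     (\<forall>k\<in>{0..<q}. \<forall>l\<in>{0..<q}. \<forall>a\<in>sq \<tau>.
        block (shift \<tau> k l) g a
        = exp (\<i> * of_real (\<theta> 0 0)) * exp (\<i> * of_real (phase (r1, r2) k l))
          * exp (- \<i> * \<psi> a) * block (shift \<tau> k l) f a)"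
    if "2 * \<tau> \<le> m" "m = \<tau> * p"
      and "\<forall>a\<in>sq \<tau>. block (shift \<tau> 0 0) \<nu> a = exp (\<i> * \<psi> a) * block (shift \<tau> 0 0) \<mu> a" for p \<psi>
  proof -
    have known: "a \<in> sq m" "\<nu> a = exp (\<i> * \<psi> a) * \<mu> a" if "a \<in> sq \<tau>" for a
      using that \<open>2 * \<tau> \<le> m\<close> \<tau>_pos sq_mono[of \<tau> m]
        bspec[OF \<open>\<forall>a\<in>sq \<tau>. _\<close> that] by (auto simp: block_def)
    have "\<nu> (a + shift \<tau> k l)
        = exp (- \<i> * of_real (phase (r1, r2) k l)) * exp (\<i> * \<psi> a) * \<mu> (a + shift \<tau> k l)"
      if "k \<in> {0..<p}" "l \<in> {0..<p}" "a \<in> sq \<tau>" for k l a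
      using probe_phase[OF known[OF that(3)], of k l] add_shift_in_sq[OF that]
      by (simp add: \<open>m = \<tau> * p\<close>)
    moreover have "g (a + shift \<tau> k l)
        = exp (\<i> * of_real (\<theta> 0 0)) * exp (\<i> * of_real (phase (r1, r2) k l))
          * exp (- \<i> * \<psi> a) * f (a + shift \<tau> k l)"
      if "k \<in> {0..<q}" "l \<in> {0..<q}" "a \<in> sq \<tau>" for k l a
      using object_phase[OF known[OF that(3)], of k l] add_shift_in_sq[OF that]
      by (simp add: wrap_id n_eq)
    ultimately show ?thesis
      by (simp add: block_def add.commute)
  qed
  \<comment> \<open>The extra shift \<open>(s, t)\<close> treats all blocks at once:
    \<open>(0, 0)\<close> gives those with indices 0 and 1, while \<open>(1, 0)\<close>,
    \<open>(0, 1)\<close> and \<open>(1, 1)\<close> give those with an index 2. Only the probe claim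
    needs the translated pixel to stay in the probe area, since the object lives on the whole
    torus.\<close>
  have part2:
    "torus_block n (shift \<tau> k l + corner m \<tau> i j + shift \<tau> s t) g a
      = exp (\<i> * of_real (\<theta> 0 0)) * exp (\<i> * of_real (phase (r1, r2) (k + s) (l + t)))
        * exp (- \<i> * block (corner m \<tau> i j) \<psi> a)
        * torus_block n (shift \<tau> k l + corner m \<tau> i j + shift \<tau> s t) f a" (is ?object)
    "corner m \<tau> i j + a + shift \<tau> s t \<in> sq m \<Longrightarrow>
      block (corner m \<tau> i j + shift \<tau> s t) \<nu> a
      = exp (- \<i> * of_real (phase (r1, r2) s t)) * exp (\<i> * block (corner m \<tau> i j) \<psi> a)
        * block (corner m \<tau> i j + shift \<tau> s t) \<mu> a" (is "_ \<Longrightarrow> ?probe")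
    if "m < 2 * \<tau>" "\<tau> < m"
      and "\<forall>i\<in>{0, 1}. \<forall>j\<in>{0, 1}. \<forall>a\<in>block_ix m \<tau> i j.
           block (corner m \<tau> i j) \<nu> a
           = exp (\<i> * block (corner m \<tau> i j) \<psi> a) * block (corner m \<tau> i j) \<mu> a"
      and "i \<in> {0, 1}" "j \<in> {0, 1}" "a \<in> block_ix m \<tau> i j" for \<psi> i j a k l s t
  proof -
    define x where "x = corner m \<tau> i j + a"
    have x: "x \<in> sq m"
      using that(1,2,4-6) by (cases a) (auto simp: x_def block_ix_iff corner_def sq_def)
    have known: "\<nu> x = exp (\<i> * \<psi> x) * \<mu> x"
      using that(3-6) unfolding block_def x_def by blast
    show ?object
      using object_phase[OF x known, of "k + s" "l + t"]
      by (simp add: torus_block_def block_def x_def shift_add ac_simps)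
    show ?probe if "corner m \<tau> i j + a + shift \<tau> s t \<in> sq m"
      using probe_phase[OF x known, of s t] that
      by (simp add: block_def x_def ac_simps)
  qed
  \<comment> \<open>In each direction that is shifted, the offset is below
    \<open>m - \<tau>\<close>, so a step by \<open>\<tau>\<close> stays below \<open>m\<close>. The
    same holds for the next two facts.\<close>
  have in_sq: "corner m \<tau> 0 j + a + shift \<tau> 1 0 \<in> sq m"
    if "\<tau> < m" "m < 2 * \<tau>" "j \<in> {0, 1}" "a \<in> block_ix m \<tau> 2 j" for j a
    using that by (cases a) (auto simp: block_ix_iff corner_def shift_def sq_def)
  have in_sq': "corner m \<tau> j 0 + a + shift \<tau> 0 1 \<in> sq m"
    if "\<tau> < m" "m < 2 * \<tau>" "j \<in> {0, 1}" "a \<in> block_ix m \<tau> j 2" for j a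
    using that by (cases a) (auto simp: block_ix_iff corner_def shift_def sq_def)
  have in_sq'': "corner m \<tau> 0 0 + a + shift \<tau> 1 1 \<in> sq m"
    if "\<tau> < m" "m < 2 * \<tau>" "a \<in> block_ix m \<tau> 2 2" for a
    using that by (cases a) (auto simp: block_ix_iff corner_def shift_def sq_def)
  show ?thesis
    apply (rule conjI)
    subgoal by (intro allI impI) (rule part1)
    subgoal premises
      \<comment> \<open>The seven claims are, in order: the object at
        \<open>(s, t) = (0, 0)\<close>, the probe at \<open>(1, 0)\<close>, \<open>(0, 1)\<close>,
        \<open>(1, 1)\<close>, and the object at these three shifts.\<close>
      apply (intro allI impI conjI ballI)
      subgoal premises prems for \<psi> k l i j a
        using part2(1)[OF prems(1-3) prems(6-8), of k l 0 0] by simp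
      subgoal premises prems for \<psi> j a
        using part2(2)[OF prems(1-3) _ prems(4) prems(5)[unfolded block_ix_2], of 1 0]
          in_sq[OF prems(2,1,4,5)]
        by (simp add: phase_simps corner_2)
      subgoal premises prems for \<psi> j a
        using part2(2)[OF prems(1-3,4) _ prems(5)[unfolded block_ix_2], of 0 1]
          in_sq'[OF prems(2,1,4,5)]
        by (simp add: phase_simps corner_2)
      subgoal premises prems for \<psi> a
        using part2(2)[OF prems(1-3) _ _ prems(4)[unfolded block_ix_2], of 1 1]
          in_sq''[OF prems(2,1,4)]
        by (simp add: phase_simps corner_22)
      subgoal premises prems for \<psi> k l j a
        using part2(1)[OF prems(1-3) _ prems(6) prems(7)[unfolded block_ix_2], of k l 1 0]
        by (simp add: corner_2 add.assoc)
      subgoal premises prems for \<psi> k l j a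
        using part2(1)[OF prems(1-3) prems(6) _ prems(7)[unfolded block_ix_2], of k l 0 1]
        by (simp add: corner_2 add.assoc)
      subgoal premises prems for \<psi> k l a
        using part2(1)[OF prems(1-3) _ _ prems(6)[unfolded block_ix_2], of k l 1 1]
        by (simp add: corner_22 add.assoc)
      done
    done
qed

end
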